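(* Let $p>1$ and let $f:\mathbb{R}^n\times[0,\infty)\to(0,\infty)$ be a smooth positive solution of the Cauchy problem $\frac{\partial f}{\partial t}=\Delta f+f^p$, $f(x,0)=f_0(x)$. Set $u=\log f$. Suppose the real constants $\alpha,\beta,a,c$ satisfy $$\alpha>\beta\ge 0,\qquad \frac{\alpha(p-1)+2\beta}{p}\ge c\ge \frac{(p-1)n\alpha^2}{4(\alpha-\beta)},$$ and $$a\ge \frac{n\alpha^2}{2(\alpha-\beta)}>0 .$$ Then for all $x\in\mathbb{R}^n$ and all $t>0$, $$\alpha\Delta u+\beta|\nabla u|^2+c\,e^{u(p-1)}+\frac{a}{t}\ge 0 .$$
   Context: $\Delta$ and $\nabla$ denote the spatial Laplacian and gradient on $\mathbb{R}^n$. *)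

theory Defs
  imports "HOL-Analysis.Analysis"
begin

fun Ck_on :: "nat \<Rightarrow> 'a::euclidean_space set \<Rightarrow> ('a \<Rightarrow> real) \<Rightarrow> bool" where
  "Ck_on 0 S g = continuous_on S g"
| "Ck_on (Suc k) S g =
     (\<exists>g'. (\<forall>x\<in>S. (g has_derivative g' x) (at x within S)) \<and>
           (\<forall>v. Ck_on k S (\<lambda>x. g' x v)))"

definition smooth_on :: "'a::euclidean_space set \<Rightarrow> ('a \<Rightarrow> real) \<Rightarrow> bool" where
  "smooth_on S g \<longleftrightarrow> (\<forall>k. Ck_on k S g)"

definition partial :: "'n::finite \<Rightarrow> (real^'n \<Rightarrow> real) \<Rightarrow> real^'n \<Rightarrow> real" where
  "partial i g x = deriv (\<lambda>s. g (x + s *\<^sub>R axis i 1)) 0"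

definition laplacian :: "(real^'n::finite \<Rightarrow> real) \<Rightarrow> real^'n \<Rightarrow> real" where
  "laplacian g x = (\<Sum>i\<in>UNIV. partial i (partial i g) x)"

definition grad_norm_sq :: "(real^'n::finite \<Rightarrow> real) \<Rightarrow> real^'n \<Rightarrow> real" where
  "grad_norm_sq g x = (\<Sum>i\<in>UNIV. (partial i g x)\<^sup>2)"

end

theory Submission
  imports Defs
begin

text \<open>
  Put \<open>u = ln f\<close>, \<open>E = e\<^bsup>(p-1)u\<^esup>\<close> and \<open>L w = w\<^sub>t - \<Delta>w - 2 \<nabla>u \<cdot> \<nabla>w\<close>. For \<open>H = \<alpha> \<Delta>u + \<beta> |\<nabla>u|\<^sup>2 + c E\<close>,
  Bochner's formula and \<open>|\<nabla>\<^sup>2u|\<^sup>2 \<ge> (\<Delta>u)\<^sup>2 / n\<close> show that at points where \<open>H \<le> 0\<close> one has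
  \<open>L H \<ge> K (\<beta> |\<nabla>u|\<^sup>2 - H)\<^sup>2\<close> with \<open>K = 2 (\<alpha> - \<beta>) / (n \<alpha>\<^sup>2)\<close>. If \<open>\<beta> > 0\<close>, the minimum principle applies to
  \<open>H + 1 / (K (t - \<delta>)) + B / (R\<^sup>2 - |x|\<^sup>2)\<^sup>2\<close> on the ball of radius \<open>R\<close> without any growth condition on \<open>f\<close>:
  the square on the right-hand side dominates the derivatives of the barrier as soon as \<open>B\<close> is a
  large multiple of \<open>R\<^sup>2\<close>. Then \<open>R \<rightarrow> \<infinity>\<close> and \<open>\<delta> \<rightarrow> 0\<close>. The case \<open>\<beta> = 0\<close> is reached as a limit \<open>\<beta>' \<down> \<beta>\<close>.
\<close>

subsection \<open>Smooth functions and mixed derivatives\<close>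

text \<open>As a total function of the point it can be iterated without differentiability side
  conditions; these enter only through \<open>smooth_on\<close> in the rules below.\<close>

definition dir_deriv :: "'a::euclidean_space \<Rightarrow> ('a \<Rightarrow> real) \<Rightarrow> 'a \<Rightarrow> real" where
  "dir_deriv v g z = frechet_derivative g (at z) v"

lemma dir_deriv_eq:
  assumes "(g has_derivative g') (at z)"
  shows "dir_deriv v g z = g' v"
  using frechet_derivative_at[OF assms] by (simp add: dir_deriv_def)

section \<open>Closure properties of functions of class C^k on a set\<close>

lemma Ck_on_subset: "Ck_on k S g \<Longrightarrow> T \<subseteq> S \<Longrightarrow> Ck_on k T g"
proof (induction k arbitrary: g)
  case 0
  then show ?case by (auto intro: continuous_on_subset)
next
  case (Suc k)
  then obtain g' where g': "\<forall>x\<in>S. (g has_derivative g' x) (at x within S)"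
    "\<forall>v. Ck_on k S (\<lambda>x. g' x v)" by auto
  then show ?case using Suc
    by (auto intro!: exI[of _ g'] intro: has_derivative_subset)
qed

lemma Ck_on_cong:
  assumes "\<And>x. x \<in> S \<Longrightarrow> g x = h x"
  shows "Ck_on k S g \<longleftrightarrow> Ck_on k S h"
proof (cases k)
  case 0
  then show ?thesis using assms by (simp cong: continuous_on_cong)
next
  case (Suc m)
  have "(g has_derivative g' x) (at x within S) \<longleftrightarrow> (h has_derivative g' x) (at x within S)"
    if "x \<in> S" for x g'
    using has_derivative_transform[OF that, of h g] has_derivative_transform[OF that, of g h] assms
    by metis
  then show ?thesis using Suc by (auto cong: ball_cong)
qed

lemma Ck_on_Suc_imp: "Ck_on (Suc k) S g \<Longrightarrow> Ck_on k S g"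
proof (induction k arbitrary: g)
  case 0
  then show ?case
    by (auto intro: has_derivative_continuous_on)
next
  case (Suc k)
  from Suc.prems obtain g' where "\<forall>x\<in>S. (g has_derivative g' x) (at x within S)"
    "\<forall>v. Ck_on (Suc k) S (\<lambda>x. g' x v)" unfolding Ck_on.simps(2)[of "Suc k"] by blast
  with Suc.IH show ?case unfolding Ck_on.simps(2)[of k] by blast
qed

lemma Ck_on_SucI:
  assumes "\<And>x. x \<in> S \<Longrightarrow> (g has_derivative g' x) (at x within S)" "\<And>v. Ck_on k S (\<lambda>x. g' x v)"
  shows "Ck_on (Suc k) S g"
  unfolding Ck_on.simps by (intro exI[of _ g'] conjI ballI allI assms)

lemma Ck_on_SucE:
  assumes "Ck_on (Suc k) S g"
  obtains g' where "\<forall>x\<in>S. (g has_derivative g' x) (at x within S)" "\<forall>v. Ck_on k S (\<lambda>x. g' x v)"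
  using assms by auto

lemma Ck_on_const: "Ck_on k S (\<lambda>_. c)"
proof (induction k arbitrary: c)
  case (Suc k)
  show ?case by (rule Ck_on_SucI[OF has_derivative_const Suc.IH])
qed simp

lemma Ck_on_add: "Ck_on k S g \<Longrightarrow> Ck_on k S h \<Longrightarrow> Ck_on k S (\<lambda>x. g x + h x)"
proof (induction k arbitrary: g h)
  case 0
  then show ?case by (simp add: continuous_on_add)
next
  case (Suc k)
  obtain g' where g': "\<forall>x\<in>S. (g has_derivative g' x) (at x within S)" "\<forall>v. Ck_on k S (\<lambda>x. g' x v)"
    using Suc.prems(1) by (rule Ck_on_SucE)
  note g' = g'[rule_format]
  obtain h' where h': "\<forall>x\<in>S. (h has_derivative h' x) (at x within S)" "\<forall>v. Ck_on k S (\<lambda>x. h' x v)"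
    using Suc.prems(2) by (rule Ck_on_SucE)
  note h' = h'[rule_format]
  show ?case
    by (rule Ck_on_SucI[OF has_derivative_add[OF g'(1) h'(1)] Suc.IH[OF g'(2) h'(2)]])
qed

lemma Ck_on_mult: "Ck_on k S g \<Longrightarrow> Ck_on k S h \<Longrightarrow> Ck_on k S (\<lambda>x. g x * h x)"
proof (induction k arbitrary: g h)
  case 0
  then show ?case by (simp add: continuous_on_mult)
next
  case (Suc k)
  obtain g' where g': "\<forall>x\<in>S. (g has_derivative g' x) (at x within S)" "\<forall>v. Ck_on k S (\<lambda>x. g' x v)"
    using Suc.prems(1) by (rule Ck_on_SucE)
  note g' = g'[rule_format]
  obtain h' where h': "\<forall>x\<in>S. (h has_derivative h' x) (at x within S)" "\<forall>v. Ck_on k S (\<lambda>x. h' x v)"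
    using Suc.prems(2) by (rule Ck_on_SucE)
  note h' = h'[rule_format]
  note gh = Suc.prems[THEN Ck_on_Suc_imp]
  show ?case
    by (rule Ck_on_SucI[OF has_derivative_mult[OF g'(1) h'(1)]
          Ck_on_add[OF Suc.IH[OF gh(1) h'(2)] Suc.IH[OF g'(2) gh(2)]]])
qed

text \<open>The derivative of \<open>g x powr r\<close> contains \<open>g x powr (r - 1)\<close>, so
  the induction has to treat all exponents at once.\<close>

lemma Ck_on_powr:
  assumes "\<And>x. x \<in> S \<Longrightarrow> g x > 0"
  shows "Ck_on k S g \<Longrightarrow> Ck_on k S (\<lambda>x. g x powr r)"
proof (induction k arbitrary: r)
  case 0
  then show ?case using assms by (auto intro!: continuous_on_powr simp: less_imp_neq[THEN not_sym])
next
  case (Suc k)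
  obtain g' where g': "\<forall>x\<in>S. (g has_derivative g' x) (at x within S)" "\<forall>v. Ck_on k S (\<lambda>x. g' x v)"
    using Suc.prems by auto
  have "Ck_on k S g"
    using Suc.prems by (auto intro: Ck_on_Suc_imp simp del: Ck_on.simps)
  then have *: "Ck_on k S (\<lambda>x. g x powr (r - 1))" by (rule Suc.IH)
  have "((\<lambda>x. g x powr r) has_derivative (\<lambda>v. (r * g x powr (r - 1)) * g' x v)) (at x within S)"
    if "x \<in> S" for x
  proof -
    have "((\<lambda>y. y powr r) has_derivative (*) (r * g x powr (r - 1))) (at (g x))"
      using has_real_derivative_powr[OF assms[OF that], of r]
      by (simp add: has_field_derivative_def)
    from has_derivative_compose[OF g'(1)[rule_format, OF that] this] show ?thesis by simp
  qed
  then show ?case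
    by (auto intro!: exI[of _ "\<lambda>x v. (r * g x powr (r - 1)) * g' x v"] Ck_on_mult Ck_on_const * g'(2)[rule_format])
qed

text \<open>The derivative is \<open>g x powr -1 * g' x v\<close>, so one differentiation reduces
  the claim to powers.\<close>

lemma Ck_on_ln:
  assumes pos: "\<And>x. x \<in> S \<Longrightarrow> g x > 0" and g: "Ck_on k S g"
  shows "Ck_on k S (\<lambda>x. ln (g x))"
proof (cases k)
  case 0
  then show ?thesis using assms by (auto intro!: continuous_on_ln simp: less_imp_neq[THEN not_sym])
next
  case (Suc m)
  obtain g' where g': "\<forall>x\<in>S. (g has_derivative g' x) (at x within S)" "\<forall>v. Ck_on m S (\<lambda>x. g' x v)"
    using g Suc by auto
  have "Ck_on m S g"
    using g Suc by (auto intro: Ck_on_Suc_imp simp del: Ck_on.simps)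
  with pos have *: "Ck_on m S (\<lambda>x. g x powr -1)" by (rule Ck_on_powr)
  have "((\<lambda>x. ln (g x)) has_derivative (\<lambda>v. g x powr -1 * g' x v)) (at x within S)"
    if "x \<in> S" for x
  proof -
    have "(ln has_derivative (*) (g x powr -1)) (at (g x))"
      using DERIV_ln[OF pos[OF that]] pos[OF that]
      by (simp add: has_field_derivative_def powr_minus)
    from has_derivative_compose[OF g'(1)[rule_format, OF that] this] show ?thesis by simp
  qed
  then show ?thesis using Suc
    by (auto intro!: exI[of _ "\<lambda>x v. g x powr -1 * g' x v"] Ck_on_mult * g'(2)[rule_format])
qed

section \<open>Smooth functions and the calculus of directional derivatives\<close>

lemma smooth_on_subset: "smooth_on S g \<Longrightarrow> T \<subseteq> S \<Longrightarrow> smooth_on T g"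
  by (auto simp: smooth_on_def intro: Ck_on_subset)

lemma smooth_onD: "smooth_on S g \<Longrightarrow> Ck_on k S g"
  by (simp add: smooth_on_def del: Ck_on.simps)

lemma smooth_on_const: "smooth_on S (\<lambda>_. c)"
  by (simp add: smooth_on_def Ck_on_const)

lemma smooth_on_add:
  "smooth_on S g \<Longrightarrow> smooth_on S h \<Longrightarrow> smooth_on S (\<lambda>x. g x + h x)"
  using Ck_on_add[OF smooth_onD smooth_onD, of S g h] by (simp add: smooth_on_def)

lemma smooth_on_mult:
  "smooth_on S g \<Longrightarrow> smooth_on S h \<Longrightarrow> smooth_on S (\<lambda>x. g x * h x)"
  using Ck_on_mult[OF smooth_onD smooth_onD, of S g h] by (simp add: smooth_on_def)

lemma smooth_on_powr:
  assumes "\<And>x. x \<in> S \<Longrightarrow> g x > 0" "smooth_on S g"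
  shows "smooth_on S (\<lambda>x. g x powr r)"
  unfolding smooth_on_def using Ck_on_powr[OF assms(1) smooth_onD[OF assms(2)]] by blast

lemma smooth_on_ln:
  assumes "\<And>x. x \<in> S \<Longrightarrow> g x > 0" "smooth_on S g"
  shows "smooth_on S (\<lambda>x. ln (g x))"
  unfolding smooth_on_def using Ck_on_ln[OF assms(1) smooth_onD[OF assms(2)]] by blast

lemma smooth_on_sum:
  "(\<And>i. i \<in> I \<Longrightarrow> smooth_on S (g i)) \<Longrightarrow> smooth_on S (\<lambda>x. \<Sum>i\<in>I. g i x)"
proof (induction I rule: infinite_finite_induct)
  case (insert i I)
  then have "smooth_on S (\<lambda>x. g i x + (\<Sum>i\<in>I. g i x))"
    by (intro smooth_on_add[of S "g i"]) auto
  with insert show ?case by simp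
qed (simp_all add: smooth_on_const)

lemma smooth_on_continuous_on: "smooth_on S g \<Longrightarrow> continuous_on S g"
  unfolding smooth_on_def using Ck_on.simps(1) by blast

lemma smooth_on_has_derivative:
  assumes "smooth_on S g" "open S" "z \<in> S"
  shows "(g has_derivative (\<lambda>v. dir_deriv v g z)) (at z)"
proof -
  have "Ck_on (Suc 0) S g" using assms by (simp add: smooth_on_def del: Ck_on.simps)
  then obtain g' where "(g has_derivative g' z) (at z within S)"
    using \<open>z \<in> S\<close> by auto
  then have "(g has_derivative g' z) (at z)"
    using assms at_within_open by metis
  then show ?thesis
    using frechet_derivative_at by (fastforce simp: dir_deriv_def[abs_def])
qed

text \<open>The derivative hidden in \<open>Ck_on\<close> is existentially quantified and may be a
  different witness for each order. On an open set derivatives are unique, so all witnesses agree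
  with \<open>dir_deriv\<close>.\<close>

lemma smooth_on_dir_deriv:
  assumes "smooth_on S g" "open S"
  shows "smooth_on S (dir_deriv v g)"
  unfolding smooth_on_def
proof
  fix k
  have "Ck_on (Suc k) S g" using assms by (simp add: smooth_on_def del: Ck_on.simps)
  then obtain g' where g': "\<And>x. x \<in> S \<Longrightarrow> (g has_derivative g' x) (at x within S)"
    "\<And>v. Ck_on k S (\<lambda>x. g' x v)" by auto
  have "dir_deriv v g x = g' x v" if "x \<in> S" for x
    using g'(1)[OF that] at_within_open[OF that \<open>open S\<close>] by (simp add: dir_deriv_eq)
  then show "Ck_on k S (dir_deriv v g)"
    using Ck_on_cong[of S "dir_deriv v g" "\<lambda>x. g' x v" k] g'(2)[of v] by simp
qed

text \<open>A derivative depends only on values near the point. This allows differentiating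
  identities that are known on \<open>S\<close> alone, such as the evolution equation.\<close>

lemma dir_deriv_cong:
  assumes "open S" "z \<in> S" "\<And>x. x \<in> S \<Longrightarrow> g x = h x"
  shows "dir_deriv v g z = dir_deriv v h z"
proof -
  have "(g has_derivative g') (at z) \<longleftrightarrow> (h has_derivative g') (at z)" for g'
    using has_derivative_transform_within_open[of g g' z UNIV S h]
      has_derivative_transform_within_open[of h g' z UNIV S g] assms by auto
  then show ?thesis by (simp add: dir_deriv_def frechet_derivative_def)
qed

lemma dir_deriv_const: "dir_deriv v (\<lambda>_. c) z = 0"
  using dir_deriv_eq[OF has_derivative_const] .

lemma dir_deriv_add:
  assumes "smooth_on S g" "smooth_on S h" "open S" "z \<in> S"
  shows "dir_deriv v (\<lambda>x. g x + h x) z = dir_deriv v g z + dir_deriv v h z"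
  using dir_deriv_eq[OF has_derivative_add[OF assms(1,2)[THEN smooth_on_has_derivative, OF assms(3,4)]]] .

lemma dir_deriv_mult:
  assumes "smooth_on S g" "smooth_on S h" "open S" "z \<in> S"
  shows "dir_deriv v (\<lambda>x. g x * h x) z = g z * dir_deriv v h z + dir_deriv v g z * h z"
  using dir_deriv_eq[OF has_derivative_mult[OF assms(1,2)[THEN smooth_on_has_derivative, OF assms(3,4)]]] .

lemma dir_deriv_cmult:
  assumes "smooth_on S g" "open S" "z \<in> S"
  shows "dir_deriv v (\<lambda>x. c * g x) z = c * dir_deriv v g z"
  using dir_deriv_mult[OF smooth_on_const assms] by (simp add: dir_deriv_const)

lemma dir_deriv_sum:
  assumes "\<And>i. i \<in> I \<Longrightarrow> smooth_on S (g i)" "open S" "z \<in> S"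
  shows "dir_deriv v (\<lambda>x. \<Sum>i\<in>I. g i x) z = (\<Sum>i\<in>I. dir_deriv v (g i) z)"
  using dir_deriv_eq[OF has_derivative_sum[OF smooth_on_has_derivative[OF assms]]] .

lemma dir_deriv_compose:
  assumes "smooth_on S g" "open S" "z \<in> S" "(\<phi> has_real_derivative d) (at (g z))"
  shows "dir_deriv v (\<lambda>x. \<phi> (g x)) z = d * dir_deriv v g z"
  using dir_deriv_eq[OF has_derivative_compose[OF smooth_on_has_derivative[OF assms(1-3)]
        assms(4)[unfolded has_field_derivative_def]]] .

text \<open>Restriction to a line gives access to one-variable calculus: the mean value theorem, the
  derivative tests at a minimum, and the coordinate derivatives of \<open>partial\<close>.\<close>

lemma smooth_on_line_deriv:
  assumes "smooth_on S g" "open S" "z + s *\<^sub>R v \<in> S"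
  shows "((\<lambda>s. g (z + s *\<^sub>R v)) has_real_derivative dir_deriv v g (z + s *\<^sub>R v)) (at s)"
proof -
  have 1: "((\<lambda>s. z + s *\<^sub>R v) has_derivative (\<lambda>s. s *\<^sub>R v)) (at s)"
    by (auto intro!: derivative_eq_intros)
  have D: "(g has_derivative (\<lambda>w. dir_deriv w g (z + s *\<^sub>R v))) (at (z + s *\<^sub>R v))"
    using smooth_on_has_derivative[OF assms] .
  have "linear (\<lambda>w. dir_deriv w g (z + s *\<^sub>R v))"
    using has_derivative_linear[OF D] .
  from linear_cmul[OF this]
  have "(\<lambda>r. dir_deriv (r *\<^sub>R v) g (z + s *\<^sub>R v)) = (*) (dir_deriv v g (z + s *\<^sub>R v))"
    by (simp add: fun_eq_iff)
  with has_derivative_compose[OF 1 D] show ?thesis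
    by (simp add: has_field_derivative_def)
qed

text \<open>Two applications of the mean value theorem turn the second difference of \<open>g\<close> into a mixed
  derivative at a nearby point; the second difference is symmetric in \<open>v\<close> and \<open>w\<close>.\<close>

lemma second_difference_mvt:
  assumes g: "smooth_on S g" "open S" and "h > 0"
    and inS: "\<And>s r. \<lbrakk>0 \<le> s; s \<le> h; 0 \<le> r; r \<le> h\<rbrakk> \<Longrightarrow> z + s *\<^sub>R v + r *\<^sub>R w \<in> S"
  obtains s r where "0 \<le> s" "s \<le> h" "0 \<le> r" "r \<le> h"
    "g (z + h *\<^sub>R v + h *\<^sub>R w) - g (z + h *\<^sub>R v) - g (z + h *\<^sub>R w) + g z
       = h\<^sup>2 * dir_deriv w (dir_deriv v g) (z + s *\<^sub>R v + r *\<^sub>R w)"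
proof -
  let ?G = "\<lambda>s. g (z + h *\<^sub>R w + s *\<^sub>R v) - g (z + s *\<^sub>R v)"
  let ?G' = "\<lambda>s. dir_deriv v g (z + h *\<^sub>R w + s *\<^sub>R v) - dir_deriv v g (z + s *\<^sub>R v)"
  have "(?G has_real_derivative ?G' s) (at s)" if "0 \<le> s" "s \<le> h" for s
  proof (intro derivative_intros smooth_on_line_deriv[OF g])
    show "z + h *\<^sub>R w + s *\<^sub>R v \<in> S" using inS[of s h] that \<open>h > 0\<close> by (simp add: ac_simps)
    show "z + s *\<^sub>R v \<in> S" using inS[of s 0] that \<open>h > 0\<close> by simp
  qed
  from MVT2[OF \<open>h > 0\<close> this] obtain s where s: "0 < s" "s < h" "?G h - ?G 0 = h * ?G' s" by auto
  have "((\<lambda>r. dir_deriv v g (z + s *\<^sub>R v + r *\<^sub>R w)) has_real_derivative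
      dir_deriv w (dir_deriv v g) (z + s *\<^sub>R v + r *\<^sub>R w)) (at r)" if "0 \<le> r" "r \<le> h" for r
    using that s inS[of s r] by (intro smooth_on_line_deriv[OF smooth_on_dir_deriv[OF g] g(2)]) auto
  from MVT2[OF \<open>h > 0\<close> this] obtain r where r: "0 < r" "r < h"
    "?G' s = h * dir_deriv w (dir_deriv v g) (z + s *\<^sub>R v + r *\<^sub>R w)"
    by (auto simp: ac_simps)
  show ?thesis
    by (rule that[of s r]) (use s r in \<open>auto simp: power2_eq_square ac_simps\<close>)
qed

text \<open>If the two mixed derivatives differed at \<open>z\<close>, continuity would keep them
  apart near \<open>z\<close>; yet at suitable nearby points both equal the same second difference
  divided by \<open>h\<^sup>2\<close>.\<close>

lemma dir_deriv_commute:
  assumes g: "smooth_on S g" "open S" "z \<in> S"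
  shows "dir_deriv w (dir_deriv v g) z = dir_deriv v (dir_deriv w g) z"
proof (rule ccontr)
  let ?A = "dir_deriv w (dir_deriv v g)" and ?B = "dir_deriv v (dir_deriv w g)"
  \<comment> \<open>Half of the gap: values within \<open>e\<close> of \<open>?A z\<close> and of
    \<open>?B z\<close> cannot coincide.\<close>
  define e where "e = \<bar>?A z - ?B z\<bar> / 2"
  assume "?A z \<noteq> ?B z"
  then have "e > 0" by (simp add: e_def)
  have "continuous (at z) ?A" "continuous (at z) ?B"
    using smooth_on_continuous_on[OF smooth_on_dir_deriv[OF smooth_on_dir_deriv[OF g(1,2)] g(2)]] g(2,3)
    by (metis continuous_on_eq_continuous_at)+
  then obtain d1 d2 where "d1 > 0" "\<And>y. dist y z < d1 \<Longrightarrow> dist (?A y) (?A z) < e"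
    and "d2 > 0" "\<And>y. dist y z < d2 \<Longrightarrow> dist (?B y) (?B z) < e"
    using \<open>e > 0\<close> unfolding continuous_within_eps_delta by (metis UNIV_I)
  moreover obtain d3 where "d3 > 0" "\<And>y. dist y z < d3 \<Longrightarrow> y \<in> S"
    using g(2,3) unfolding open_dist by blast
  ultimately obtain d where "d > 0" and d:
    "\<And>y. dist y z < d \<Longrightarrow> dist (?A y) (?A z) < e \<and> dist (?B y) (?B z) < e \<and> y \<in> S"
    using that[of "min d1 (min d2 d3)"] by auto
  \<comment> \<open>The parallelogram spanned by \<open>h *\<^sub>R v\<close> and
    \<open>h *\<^sub>R w\<close> stays within distance \<open>d\<close> of \<open>z\<close>; the
    summand 1 keeps the denominator positive when both vectors vanish.\<close>
  define h where "h = d / (2 * (norm v + norm w + 1))"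
  have n: "norm v + norm w + 1 > 0" by (simp add: add_nonneg_pos)
  then have "h > 0" using \<open>d > 0\<close> by (simp add: h_def)
  have near: "dist (z + s *\<^sub>R v + r *\<^sub>R w) z < d" if "0 \<le> s" "s \<le> h" "0 \<le> r" "r \<le> h" for s r
  proof -
    have "dist (z + s *\<^sub>R v + r *\<^sub>R w) z = norm (s *\<^sub>R v + r *\<^sub>R w)" by (simp add: dist_norm add.assoc)
    also have "\<dots> \<le> s * norm v + r * norm w" using that norm_triangle_ineq[of "s *\<^sub>R v" "r *\<^sub>R w"] by simp
    also have "\<dots> \<le> h * norm v + h * norm w" using that by (intro add_mono mult_right_mono) auto
    also have "\<dots> < h * (2 * (norm v + norm w + 1))" using \<open>h > 0\<close> n
      by (simp add: algebra_simps) (smt (verit) mult_nonneg_nonneg norm_ge_zero)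
    also have "\<dots> = d" using n by (simp add: h_def)
    finally show ?thesis .
  qed
  have near': "dist (z + s *\<^sub>R w + r *\<^sub>R v) z < d" if "0 \<le> s" "s \<le> h" "0 \<le> r" "r \<le> h" for s r
    using near[of r s] that by (simp add: ac_simps)
  obtain s r where 1: "0 \<le> s" "s \<le> h" "0 \<le> r" "r \<le> h"
    "g (z + h *\<^sub>R v + h *\<^sub>R w) - g (z + h *\<^sub>R v) - g (z + h *\<^sub>R w) + g z = h\<^sup>2 * ?A (z + s *\<^sub>R v + r *\<^sub>R w)"
    using second_difference_mvt[OF g(1,2) \<open>h > 0\<close>, of z v w] near d by metis
  obtain s' r' where 2: "0 \<le> s'" "s' \<le> h" "0 \<le> r'" "r' \<le> h"
    "g (z + h *\<^sub>R w + h *\<^sub>R v) - g (z + h *\<^sub>R w) - g (z + h *\<^sub>R v) + g z = h\<^sup>2 * ?B (z + s' *\<^sub>R w + r' *\<^sub>R v)"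
    using second_difference_mvt[OF g(1,2) \<open>h > 0\<close>, of z w v] near' d by metis
  have "h\<^sup>2 * ?A (z + s *\<^sub>R v + r *\<^sub>R w) = h\<^sup>2 * ?B (z + s' *\<^sub>R w + r' *\<^sub>R v)"
    using 1(5) 2(5) unfolding add.assoc add.commute[of "h *\<^sub>R w"] by linarith
  then have "?A (z + s *\<^sub>R v + r *\<^sub>R w) = ?B (z + s' *\<^sub>R w + r' *\<^sub>R v)" using \<open>h > 0\<close> by simp
  moreover have "dist (?A (z + s *\<^sub>R v + r *\<^sub>R w)) (?A z) < e" "dist (?B (z + s' *\<^sub>R w + r' *\<^sub>R v)) (?B z) < e"
    using d near near' 1 2 by auto
  ultimately show False by (auto simp: e_def dist_real_def abs_if split: if_splits)
qed

section \<open>Second-order rules\<close>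

lemma dir_deriv2_add:
  assumes g: "smooth_on S g" and h: "smooth_on S h" and S: "open S" "z \<in> S"
  shows "dir_deriv v (dir_deriv w (\<lambda>x. g x + h x)) z
    = dir_deriv v (dir_deriv w g) z + dir_deriv v (dir_deriv w h) z"
proof -
  have "dir_deriv v (dir_deriv w (\<lambda>x. g x + h x)) z = dir_deriv v (\<lambda>x. dir_deriv w g x + dir_deriv w h x) z"
    by (rule dir_deriv_cong[OF S dir_deriv_add[OF g h S(1)]])
  then show ?thesis
    by (simp add: dir_deriv_add[OF smooth_on_dir_deriv[OF g S(1)] smooth_on_dir_deriv[OF h S(1)] S])
qed

lemma dir_deriv2_cmult:
  assumes g: "smooth_on S g" and S: "open S" "z \<in> S"
  shows "dir_deriv v (dir_deriv w (\<lambda>x. c * g x)) z = c * dir_deriv v (dir_deriv w g) z"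
proof -
  have "dir_deriv v (dir_deriv w (\<lambda>x. c * g x)) z = dir_deriv v (\<lambda>x. c * dir_deriv w g x) z"
    by (rule dir_deriv_cong[OF S dir_deriv_cmult[OF g S(1)]])
  then show ?thesis
    by (simp add: dir_deriv_cmult[OF smooth_on_dir_deriv[OF g S(1)] S])
qed

lemma dir_deriv2_mult:
  assumes g: "smooth_on S g" and h: "smooth_on S h" and S: "open S" "z \<in> S"
  shows "dir_deriv v (dir_deriv w (\<lambda>x. g x * h x)) z
    = g z * dir_deriv v (dir_deriv w h) z + dir_deriv v g z * dir_deriv w h z
      + dir_deriv w g z * dir_deriv v h z + dir_deriv v (dir_deriv w g) z * h z"
proof -
  note sm = g h smooth_on_dir_deriv[OF g S(1)] smooth_on_dir_deriv[OF h S(1)]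
  have "dir_deriv v (dir_deriv w (\<lambda>x. g x * h x)) z
      = dir_deriv v (\<lambda>x. g x * dir_deriv w h x + dir_deriv w g x * h x) z"
    by (rule dir_deriv_cong[OF S dir_deriv_mult[OF g h S(1)]])
  then show ?thesis
    by (simp add: dir_deriv_add[OF smooth_on_mult smooth_on_mult S] dir_deriv_mult[OF _ _ S] sm)
qed

subsection \<open>Evolution of the Harnack quantity\<close>

abbreviation dx :: "'n::finite \<Rightarrow> ((real^'n) \<times> real \<Rightarrow> real) \<Rightarrow> (real^'n) \<times> real \<Rightarrow> real" where
  "dx i \<equiv> dir_deriv (axis i 1, 0)"

abbreviation dt :: "((real^'n::finite) \<times> real \<Rightarrow> real) \<Rightarrow> (real^'n) \<times> real \<Rightarrow> real" where
  "dt \<equiv> dir_deriv (0, 1)"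

text \<open>For a solution \<open>f\<close> of the heat equation with source \<open>f\<^sup>p\<close> take \<open>u = ln f\<close>, \<open>E = f\<^bsup>p-1\<^esup>\<close>
  and \<open>q = p - 1\<close>.\<close>

locale log_heat =
  fixes u E :: "(real^'n::finite) \<times> real \<Rightarrow> real" and q :: real and S :: "((real^'n) \<times> real) set"
  assumes open_S: "open S"
    and smooth_u: "smooth_on S u" and smooth_E: "smooth_on S E"
    and deriv_E: "z \<in> S \<Longrightarrow> dir_deriv v E z = q * E z * dir_deriv v u z"
    and evolution: "z \<in> S \<Longrightarrow> dt u z = (\<Sum>i\<in>UNIV. dx i (dx i u) z) + (\<Sum>i\<in>UNIV. (dx i u z)\<^sup>2) + E z"
begin

text \<open>The linearization at \<open>u\<close> of the operator w_t - \<Delta>w - |\<nabla>w|^2,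
  which sends \<open>u\<close> itself to \<open>E\<close>.\<close>

definition L :: "((real^'n) \<times> real \<Rightarrow> real) \<Rightarrow> (real^'n) \<times> real \<Rightarrow> real" where
  "L w z = dt w z - (\<Sum>i\<in>UNIV. dx i (dx i w) z) - 2 * (\<Sum>i\<in>UNIV. dx i u z * dx i w z)"

lemmas smooth_dir = smooth_on_dir_deriv[OF _ open_S]
lemmas smooth_rules = smooth_on_add smooth_on_mult smooth_on_const smooth_on_sum smooth_dir smooth_u smooth_E

lemma L_add:
  assumes "smooth_on S g" "smooth_on S h" "z \<in> S"
  shows "L (\<lambda>x. g x + h x) z = L g z + L h z"
  using assms open_S by (simp add: L_def dir_deriv_add[of S] dir_deriv2_add[of S] sum.distrib algebra_simps)

lemma L_cmult:
  assumes "smooth_on S g" "z \<in> S"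
  shows "L (\<lambda>x. c * g x) z = c * L g z"
  using assms open_S
  by (simp add: L_def dir_deriv_cmult[of S] dir_deriv2_cmult[of S] sum_distrib_left algebra_simps)

lemma L_sum:
  assumes "\<And>i. i \<in> I \<Longrightarrow> smooth_on S (g i)" "finite I" "z \<in> S"
  shows "L (\<lambda>x. \<Sum>i\<in>I. g i x) z = (\<Sum>i\<in>I. L (g i) z)"
  using assms(2,1)
proof (induction I)
  case empty
  have "dir_deriv v (\<lambda>_. 0) = (\<lambda>_::(real^'n) \<times> real. 0)" for v
    by (simp add: fun_eq_iff dir_deriv_const)
  then show ?case by (simp add: L_def)
next
  case (insert i I)
  then have "L (\<lambda>x. g i x + (\<Sum>i\<in>I. g i x)) z = L (g i) z + L (\<lambda>x. \<Sum>i\<in>I. g i x) z"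
    by (intro L_add smooth_on_sum \<open>z \<in> S\<close>) auto
  with insert show ?case by simp
qed

text \<open>The time derivative and the drift obey the Leibniz rule; the extra gradient product
  comes from the Laplacian.\<close>

lemma L_mult:
  assumes "smooth_on S g" "smooth_on S h" "z \<in> S"
  shows "L (\<lambda>x. g x * h x) z = g z * L h z + h z * L g z - 2 * (\<Sum>i\<in>UNIV. dx i g z * dx i h z)"
  using assms open_S
  by (simp add: L_def dir_deriv_mult[of S] dir_deriv2_mult[of S] sum.distrib sum_distrib_left algebra_simps)

lemma dir_deriv_commute2:
  assumes "smooth_on S g" "z \<in> S"
  shows "dir_deriv v (dir_deriv w (dir_deriv w g)) z = dir_deriv w (dir_deriv w (dir_deriv v g)) z"
proof -
  have "dir_deriv v (dir_deriv w (dir_deriv w g)) z = dir_deriv w (dir_deriv v (dir_deriv w g)) z"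
    by (intro dir_deriv_commute[of S] smooth_dir assms open_S)
  also have "\<dots> = dir_deriv w (dir_deriv w (dir_deriv v g)) z"
    by (intro dir_deriv_cong[OF open_S \<open>z \<in> S\<close>] dir_deriv_commute[of S] assms open_S)
  finally show ?thesis .
qed

text \<open>The commutator of \<open>L\<close> with a spatial derivative: partial derivatives
  commute, so only the derivative of the drift coefficient 2 \<nabla>u remains.\<close>

lemma L_dx:
  assumes g: "smooth_on S g" and z: "z \<in> S"
  shows "L (dx j g) z = dx j (L g) z + 2 * (\<Sum>i\<in>UNIV. dx i (dx j u) z * dx i g z)"
proof -
  \<comment> \<open>Differences are rewritten as sums with constant factors, to which the rules for
    sums and constant multiples apply.\<close>
  have eq: "L g = (\<lambda>z. dt g z + ((-1) * (\<Sum>i\<in>UNIV. dx i (dx i g) z) + (-2) * (\<Sum>i\<in>UNIV. dx i u z * dx i g z)))"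
    by (auto simp: L_def)
  have "dx j (L g) z = dx j (dt g) z + ((-1) * (\<Sum>i\<in>UNIV. dx j (dx i (dx i g)) z)
      + (-2) * (\<Sum>i\<in>UNIV. dx i u z * dx j (dx i g) z + dx j (dx i u) z * dx i g z))"
    unfolding eq
    by (subst dir_deriv_add[OF _ _ open_S z] dir_deriv_cmult[OF _ open_S z] dir_deriv_sum[OF _ open_S z]
          dir_deriv_mult[OF _ _ open_S z]; (intro smooth_rules g)?)+ (rule refl)
  also have "dx j (dt g) z = dt (dx j g) z"
    by (rule dir_deriv_commute[OF g open_S z])
  also have "(\<Sum>i\<in>UNIV. dx j (dx i (dx i g)) z) = (\<Sum>i\<in>UNIV. dx i (dx i (dx j g)) z)"
    by (intro sum.cong refl dir_deriv_commute2 g z)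
  also have "(\<Sum>i\<in>UNIV. dx i u z * dx j (dx i g) z + dx j (dx i u) z * dx i g z)
    = (\<Sum>i\<in>UNIV. dx i u z * dx i (dx j g) z) + (\<Sum>i\<in>UNIV. dx i (dx j u) z * dx i g z)"
    by (simp add: sum.distrib dir_deriv_commute[OF g open_S z, of "(axis j 1, 0)"]
        dir_deriv_commute[OF smooth_u open_S z, of "(axis j 1, 0)"])
  finally show ?thesis unfolding L_def[of "dx j g" z] by (simp add: algebra_simps)
qed

section \<open>Bochner-type identities for the gradient, the Laplacian and the source term\<close>

definition grad_sq :: "(real^'n) \<times> real \<Rightarrow> real" where
  "grad_sq z = (\<Sum>i\<in>UNIV. (dx i u z)\<^sup>2)"

definition lap :: "(real^'n) \<times> real \<Rightarrow> real" where
  "lap z = (\<Sum>i\<in>UNIV. dx i (dx i u) z)"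

definition hess_sq :: "(real^'n) \<times> real \<Rightarrow> real" where
  "hess_sq z = (\<Sum>j\<in>UNIV. \<Sum>i\<in>UNIV. (dx i (dx j u) z)\<^sup>2)"

lemma smooth_lap: "smooth_on S lap" and smooth_grad_sq: "smooth_on S grad_sq"
  unfolding lap_def[abs_def] grad_sq_def[abs_def] power2_eq_square by (intro smooth_rules)+

lemma L_u: "z \<in> S \<Longrightarrow> L u z = E z + (-1) * grad_sq z"
  by (simp add: L_def evolution grad_sq_def power2_eq_square)

text \<open>Differentiating L u = E - |\<nabla>u|^2 produces a derivative of |\<nabla>u|^2 that
  cancels the commutator term of \<open>L_dx\<close>.\<close>

lemma L_dx_u:
  assumes z: "z \<in> S"
  shows "L (dx j u) z = dx j E z"
proof -
  have "dx j (L u) z = dx j (\<lambda>z. E z + (-1) * grad_sq z) z"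
    using dir_deriv_cong[OF open_S z L_u] by simp
  also have "\<dots> = dx j E z - dx j grad_sq z"
    using dir_deriv_add[OF smooth_E smooth_on_mult[OF smooth_on_const smooth_grad_sq] open_S z, of "(axis j 1, 0)" "-1"]
      dir_deriv_cmult[OF smooth_grad_sq open_S z, of _ "-1"] by simp
  also have "dx j grad_sq z = (\<Sum>i\<in>UNIV. dx i u z * dx j (dx i u) z + dx j (dx i u) z * dx i u z)"
    unfolding grad_sq_def[abs_def] power2_eq_square
    by (subst dir_deriv_sum[OF _ open_S z] dir_deriv_mult[OF _ _ open_S z]; (intro smooth_rules)?)+ (rule refl)
  also have "\<dots> = 2 * (\<Sum>i\<in>UNIV. dx i (dx j u) z * dx i u z)"
    by (simp add: dir_deriv_commute[OF smooth_u open_S z, of "(axis j 1, 0)"] mult.commute sum_distrib_left)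
  finally show ?thesis using L_dx[OF smooth_u z, of j] by simp
qed

text \<open>Bochner's formula: by \<open>L_mult\<close> each square of \<open>dx j u\<close>
  contributes twice \<open>dx j u\<close> times \<open>dx j E\<close>, minus twice the squared
  gradient of \<open>dx j u\<close>.\<close>

lemma L_grad_sq:
  assumes z: "z \<in> S"
  shows "L grad_sq z = 2 * q * E z * grad_sq z - 2 * hess_sq z"
proof -
  have "L grad_sq z = (\<Sum>j\<in>UNIV. L (\<lambda>x. dx j u x * dx j u x) z)"
    unfolding grad_sq_def[abs_def] power2_eq_square by (rule L_sum[OF _ _ z]) (intro smooth_rules | simp)+
  also have "\<dots> = (\<Sum>j\<in>UNIV. 2 * q * E z * (dx j u z)\<^sup>2 - 2 * (\<Sum>i\<in>UNIV. (dx i (dx j u) z)\<^sup>2))"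
    by (simp add: L_mult[OF smooth_dir smooth_dir z] smooth_u L_dx_u z deriv_E power2_eq_square ac_simps)
  finally show ?thesis by (simp add: sum_subtractf grad_sq_def hess_sq_def sum_distrib_left)
qed

lemma dxx_E: 
  assumes z: "z \<in> S"
  shows "dx j (dx j E) z = q * E z * dx j (dx j u) z + q\<^sup>2 * E z * (dx j u z)\<^sup>2"
proof -
  have "dx j (dx j E) z = dx j (\<lambda>z. q * E z * dx j u z) z"
    by (rule dir_deriv_cong[OF open_S z deriv_E])
  also have "\<dots> = q * E z * dx j (dx j u) z + q * dx j E z * dx j u z"
    by (simp add: dir_deriv_mult[OF _ _ open_S z] dir_deriv_cmult[OF smooth_E open_S z] smooth_on_mult smooth_on_const smooth_u smooth_E smooth_dir)
  finally show ?thesis by (simp add: deriv_E z power2_eq_square)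
qed

lemma lap_E: 
  assumes z: "z \<in> S"
  shows "(\<Sum>j\<in>UNIV. dx j (dx j E) z) = q * E z * lap z + q\<^sup>2 * E z * grad_sq z"
  by (simp add: dxx_E z sum.distrib lap_def grad_sq_def sum_distrib_left)

text \<open>The commutator formula is applied to \<open>dx j u\<close>, whose image under
  \<open>L\<close> is \<open>dx j E\<close>. The Hessian now enters with the sign opposite to that
  in \<open>L_grad_sq\<close>, whence the factor \<open>\<alpha> - \<beta>\<close> later.\<close>

lemma L_lap:
  assumes z: "z \<in> S"
  shows "L lap z = q * E z * lap z + q\<^sup>2 * E z * grad_sq z + 2 * hess_sq z"
proof -
  have "L lap z = (\<Sum>j\<in>UNIV. L (dx j (dx j u)) z)"
    unfolding lap_def[abs_def] by (rule L_sum[OF _ _ z]) (intro smooth_rules | simp)+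
  also have "\<dots> = (\<Sum>j\<in>UNIV. dx j (dx j E) z + 2 * (\<Sum>i\<in>UNIV. (dx i (dx j u) z)\<^sup>2))"
    using L_dx[OF smooth_dir[OF smooth_u] z] dir_deriv_cong[OF open_S z L_dx_u]
    by (simp add: power2_eq_square)
  finally show ?thesis by (simp add: sum.distrib lap_E z hess_sq_def sum_distrib_left)
qed

text \<open>Since \<open>dt E\<close> is q E (\<Delta>u + |\<nabla>u|^2 + E), its Laplacian part
  cancels against the one in \<Delta>E.\<close>

lemma L_E:
  assumes z: "z \<in> S"
  shows "L E z = q * E z * (E z - (q + 1) * grad_sq z)"
proof -
  have "(\<Sum>i\<in>UNIV. dx i u z * dx i E z) = q * E z * grad_sq z"
    by (simp add: deriv_E z grad_sq_def sum_distrib_left power2_eq_square ac_simps)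
  then show ?thesis unfolding L_def
    by (simp add: lap_E z deriv_E[OF z, of "(0,1)"] evolution[OF z, folded lap_def grad_sq_def] algebra_simps power2_eq_square)
qed

definition harnack :: "real \<Rightarrow> real \<Rightarrow> real \<Rightarrow> (real^'n) \<times> real \<Rightarrow> real" where
  "harnack \<alpha> \<beta> c z = \<alpha> * lap z + (\<beta> * grad_sq z + c * E z)"

lemma smooth_harnack: "smooth_on S (harnack \<alpha> \<beta> c)"
  unfolding harnack_def[abs_def] by (intro smooth_rules smooth_lap smooth_grad_sq)

text \<open>The three identities are combined so that all gradient terms share one coefficient; with
  q + 1 = p, the upper bound on \<open>c\<close> says exactly that this coefficient is
  nonnegative.\<close>

lemma L_harnack:
  assumes z: "z \<in> S"
  shows "L (harnack \<alpha> \<beta> c) z = 2 * (\<alpha> - \<beta>) * hess_sq z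
    + q * E z * (\<alpha> * lap z + (\<alpha> * q + 2 * \<beta> - c * (q + 1)) * grad_sq z + c * E z)"
proof -
  have "L (harnack \<alpha> \<beta> c) z = \<alpha> * L lap z + (\<beta> * L grad_sq z + c * L E z)"
    unfolding harnack_def[abs_def]
    by (simp add: L_add[OF _ _ z] L_cmult[OF _ z] smooth_on_add smooth_on_mult smooth_on_const smooth_lap smooth_grad_sq smooth_E)
  then show ?thesis
    by (simp add: L_lap L_grad_sq L_E z algebra_simps power2_eq_square)
qed

text \<open>Cauchy-Schwarz bounds the squared trace by the diagonal entries of the Hessian; the
  off-diagonal squares only add to the right-hand side.\<close>

lemma hess_sq_ge: "(lap z)\<^sup>2 \<le> real CARD('n) * hess_sq z"
proof -
  have "(lap z)\<^sup>2 \<le> real CARD('n) * (\<Sum>i\<in>UNIV. (dx i (dx i u) z)\<^sup>2)"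
    using Cauchy_Schwarz_ineq_sum[of "\<lambda>_. 1" "\<lambda>i. dx i (dx i u) z" UNIV] by (simp add: lap_def)
  also have "\<dots> \<le> real CARD('n) * hess_sq z"
    unfolding hess_sq_def by (intro mult_left_mono sum_mono member_le_sum) auto
  finally show ?thesis .
qed

end

subsection \<open>The minimum principle\<close>

text \<open>If \<open>d < 0\<close>, then \<open>F'\<close> is negative just to the right of 0, and
  the mean value theorem gives a value of \<open>F\<close> below the minimum.\<close>

lemma second_derivative_test:
  fixes F F' :: "real \<Rightarrow> real"
  assumes "e > 0"
    and F: "\<And>s. \<bar>s\<bar> < e \<Longrightarrow> (F has_real_derivative F' s) (at s)"
    and F': "(F' has_real_derivative d) (at 0)"
    and min: "\<And>s. \<bar>s\<bar> < e \<Longrightarrow> F 0 \<le> F s"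
  shows "F' 0 = 0" "d \<ge> 0"
proof -
  show z: "F' 0 = 0"
    using DERIV_local_min[OF F[of 0] \<open>e > 0\<close>] min \<open>e > 0\<close> by simp
  show "d \<ge> 0"
  proof (rule ccontr)
    assume "\<not> d \<ge> 0"
    then obtain e' where e': "e' > 0" "\<And>h. 0 < h \<Longrightarrow> h < e' \<Longrightarrow> F' (0 + h) < F' 0"
      using DERIV_neg_dec_right[OF F'] by auto
    define h where "h = min e e' / 2"
    have h: "0 < h" "h < e" "h < e'" using \<open>e > 0\<close> e' by (auto simp: h_def min_def)
    obtain s where s: "0 < s" "s < h" "F h - F 0 = (h - 0) * F' s"
      using MVT2[of 0 h F F'] F h by (metis abs_of_nonneg le_less_trans)
    then have "F' s < 0" using e'(2)[of s] h z by simp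
    then have "F h < F 0" using s h mult_pos_neg[of h "F' s"] by simp
    with min[of h] h show False by simp
  qed
qed

text \<open>One-sided, because a minimum over a time interval may lie at its final time.\<close>

lemma left_derivative_test:
  fixes F :: "real \<Rightarrow> real"
  assumes "e > 0" and F: "(F has_real_derivative d) (at t)"
    and min: "\<And>s. t - e < s \<Longrightarrow> s \<le> t \<Longrightarrow> F t \<le> F s"
  shows "d \<le> 0"
proof (rule ccontr)
  assume "\<not> d \<le> 0"
  then obtain e' where e': "e' > 0" "\<And>h. 0 < h \<Longrightarrow> h < e' \<Longrightarrow> F (t - h) < F t"
    using DERIV_pos_inc_left[OF F] by auto
  define h where "h = min e e' / 2"
  have h: "0 < h" "h < e" "h < e'" using \<open>e > 0\<close> e' by (auto simp: h_def min_def)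
  with e'(2)[of h] min[of "t - h"] show False by simp
qed

lemma norm_add_axis_sq:
  fixes x :: "real^'n::finite"
  shows "(norm (x + s *\<^sub>R axis i 1))\<^sup>2 = (norm x)\<^sup>2 + 2 * s * x $ i + s\<^sup>2"
  unfolding power2_norm_eq_inner
  by (simp add: inner_add_left inner_add_right inner_axis inner_commute[of "axis i 1"]
      algebra_simps power2_eq_square)

text \<open>This form of the quotient rule raises the denominator by one power only; it serves the
  barrier and its derivatives with m = 1, 2, 3.\<close>

lemma DERIV_divide_power:
  fixes r :: "real \<Rightarrow> real"
  assumes "(v has_real_derivative e) (at s)" "(r has_real_derivative d) (at s)" "r s \<noteq> 0"
  shows "((\<lambda>s. v s / r s ^ m) has_real_derivative e / r s ^ m - real m * v s * d / r s ^ Suc m) (at s)"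
proof -
  have "((\<lambda>s. v s / r s ^ m) has_real_derivative
      (e * r s ^ m - v s * (real m * (d * r s ^ (m - Suc 0)))) / (r s ^ m * r s ^ m)) (at s)"
    using assms by (intro DERIV_divide DERIV_power) auto
  moreover have "(e * r s ^ m - v s * (real m * (d * r s ^ (m - Suc 0)))) / (r s ^ m * r s ^ m)
      = e / r s ^ m - real m * v s * d / r s ^ Suc m"
    using assms(3) by (cases m) (simp_all add: field_simps)
  ultimately show ?thesis by simp
qed

section \<open>The differential inequality and the barrier argument\<close>

context log_heat
begin

text \<open>With s = \<beta> |\<nabla>u|^2 - H one has -\<alpha> \<Delta>u = s + c E, so the trace
  bound makes \<open>L_harnack\<close> a quadratic form in s and \<open>E\<close>. Here
  \<open>quad\<close> says that the form dominates K s^2, and s is at least \<beta> |\<nabla>u|^2 +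
  h.\<close>

lemma L_harnack_ge:
  assumes z: "z \<in> S" and "E z \<ge> 0" "q \<ge> 0" and "\<alpha> > \<beta>" "\<beta> \<ge> 0"
    and c: "c * (q + 1) \<le> \<alpha> * q + 2 * \<beta>"
    and quad: "\<And>s e. 0 \<le> s \<Longrightarrow> 0 \<le> e \<Longrightarrow>
      K * s\<^sup>2 \<le> 2 * (\<alpha> - \<beta>) / (real CARD('n) * \<alpha>\<^sup>2) * (s + c * e)\<^sup>2 - q * e * (s + c * e) + q * c * e\<^sup>2"
    and "K \<ge> 0" and h: "h \<ge> 0" "harnack \<alpha> \<beta> c z \<le> - h"
  shows "K * (\<beta> * grad_sq z + h)\<^sup>2 \<le> L (harnack \<alpha> \<beta> c) z"
proof -
  define s where "s = \<beta> * grad_sq z - harnack \<alpha> \<beta> c z"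
  have g: "grad_sq z \<ge> 0" by (simp add: grad_sq_def sum_nonneg)
  have "\<alpha> > 0" using assms by simp
  have s: "\<beta> * grad_sq z + h \<le> s" "0 \<le> \<beta> * grad_sq z + h" using h g \<open>\<beta> \<ge> 0\<close> by (auto simp: s_def)
  have y: "s + c * E z = - \<alpha> * lap z" by (simp add: s_def harnack_def)
  have "K * (\<beta> * grad_sq z + h)\<^sup>2 \<le> K * s\<^sup>2"
    using s \<open>K \<ge> 0\<close> by (intro mult_left_mono power_mono)
  also have "\<dots> \<le> 2 * (\<alpha> - \<beta>) / (real CARD('n) * \<alpha>\<^sup>2) * (s + c * E z)\<^sup>2 - q * E z * (s + c * E z) + q * c * (E z)\<^sup>2"
    using s \<open>E z \<ge> 0\<close> by (intro quad) auto
  also have "\<dots> = 2 * (\<alpha> - \<beta>) * ((lap z)\<^sup>2 / real CARD('n)) + q * E z * (\<alpha> * lap z + c * E z)"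
    unfolding y using \<open>\<alpha> > 0\<close> by (simp add: power_mult_distrib field_simps power2_eq_square)
  also have "\<dots> \<le> 2 * (\<alpha> - \<beta>) * hess_sq z + q * E z * (\<alpha> * lap z + (\<alpha> * q + 2 * \<beta> - c * (q + 1)) * grad_sq z + c * E z)"
  proof (rule add_mono; rule mult_left_mono)
    show "(lap z)\<^sup>2 / real CARD('n) \<le> hess_sq z" using hess_sq_ge[of z] by (simp add: field_simps)
    show "\<alpha> * lap z + c * E z \<le> \<alpha> * lap z + (\<alpha> * q + 2 * \<beta> - c * (q + 1)) * grad_sq z + c * E z"
      using c g by simp
  qed (use assms in auto)
  finally show ?thesis by (simp add: L_harnack z)
qed

text \<open>The barrier blows up at time \<delta> and on the sphere of radius R, so a negative value
  forces a minimum inside, where derivative tests contradict \<open>L_harnack_ge\<close>. The time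
  part solves y' = -K y^2. Starting at \<delta> > 0 keeps the closed cylinder inside
  \<open>S\<close>, where H is bounded.\<close>

lemma harnack_barrier:
  assumes S: "S = UNIV \<times> {0<..}"
    and E: "\<And>z. z \<in> S \<Longrightarrow> E z \<ge> 0" and "q \<ge> 0" and "\<alpha> > \<beta>" "\<beta> > 0"
    and c: "c * (q + 1) \<le> \<alpha> * q + 2 * \<beta>"
    and quad: "\<And>s e. 0 \<le> s \<Longrightarrow> 0 \<le> e \<Longrightarrow>
      K * s\<^sup>2 \<le> 2 * (\<alpha> - \<beta>) / (real CARD('n) * \<alpha>\<^sup>2) * (s + c * e)\<^sup>2 - q * e * (s + c * e) + q * c * e\<^sup>2"
    and K: "K > 0" and \<delta>: "0 < \<delta>" "\<delta> < t\<^sub>0" and x0: "norm x\<^sub>0 < R"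
    and B: "B > 0" "(4 * real CARD('n) + 24 + 8 / (K * \<beta>)) * R\<^sup>2 \<le> K * B"
  shows "0 \<le> harnack \<alpha> \<beta> c (x\<^sub>0, t\<^sub>0) + (1 / (K * (t\<^sub>0 - \<delta>)) + B / (R\<^sup>2 - (norm x\<^sub>0)\<^sup>2)\<^sup>2)"
proof (rule ccontr)
  let ?H = "harnack \<alpha> \<beta> c"
  define P where "P z = 1 / (K * (snd z - \<delta>)) + B / (R\<^sup>2 - (norm (fst z))\<^sup>2)\<^sup>2" for z :: "(real^'n) \<times> real"
  define W where "W z = ?H z + P z" for z
  assume "\<not> ?thesis"
  then have neg: "W (x\<^sub>0, t\<^sub>0) < 0" by (simp add: W_def P_def)
  have "R > 0" using x0 norm_ge_zero[of x\<^sub>0] by linarith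
  define C where "C = cball (0::real^'n) R \<times> {\<delta>..t\<^sub>0}"
  have "compact C" by (simp add: C_def compact_Times)
  have "C \<subseteq> S" using \<delta> by (auto simp: C_def S)
  have contH: "continuous_on C ?H"
    using smooth_on_continuous_on[OF smooth_harnack] \<open>C \<subseteq> S\<close> by (rule continuous_on_subset)
  from compact_continuous_image[OF this \<open>compact C\<close>] have "bounded (?H ` C)" by (rule compact_imp_bounded)
  then obtain M where "M > 0" and M: "\<And>z. z \<in> C \<Longrightarrow> \<bar>?H z\<bar> \<le> M"
    by (auto simp: bounded_pos)
  \<comment> \<open>The barrier exceeds \<open>M\<close> outside of \<open>N\<close>, so every point with \<open>W < 0\<close> lies in the compact set \<open>N\<close>.\<close>
  define N where "N = C \<inter> {z. 1 / (K * M) \<le> snd z - \<delta> \<and> B / M \<le> (R\<^sup>2 - (norm (fst z))\<^sup>2)\<^sup>2}"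
  have "closed {z::(real^'n) \<times> real. 1 / (K * M) \<le> snd z - \<delta> \<and> B / M \<le> (R\<^sup>2 - (norm (fst z))\<^sup>2)\<^sup>2}"
    by (intro closed_Collect_conj closed_Collect_le continuous_intros)
  then have "compact N" unfolding N_def using \<open>compact C\<close> by (rule compact_Int_closed[rotated])
  have \<rho>pos: "R\<^sup>2 - (norm x)\<^sup>2 > 0" if "norm x < R" for x :: "real^'n"
    using power_strict_mono[OF that, of 2] by simp
  have inN: "z \<in> N" if "norm (fst z) < R" "\<delta> < snd z" "snd z \<le> t\<^sub>0" "W z < 0" for z
  proof -
    have "z \<in> C" using that by (cases z) (auto simp: C_def)
    have "P z < M" using M[OF \<open>z \<in> C\<close>] that by (auto simp: W_def)
    moreover have p1: "0 < 1 / (K * (snd z - \<delta>))" using K that by simp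
    moreover have p2: "0 < B / (R\<^sup>2 - (norm (fst z))\<^sup>2)\<^sup>2" using B \<rho>pos[OF that(1)] by simp
    ultimately have "1 / (K * (snd z - \<delta>)) < M" "B / (R\<^sup>2 - (norm (fst z))\<^sup>2)\<^sup>2 < M"
      unfolding P_def by linarith+
    then have "1 / (K * M) \<le> snd z - \<delta>" "B / M \<le> (R\<^sup>2 - (norm (fst z))\<^sup>2)\<^sup>2"
      using K that \<open>M > 0\<close> \<rho>pos[OF that(1)] by (auto simp: field_simps)
    with \<open>z \<in> C\<close> show ?thesis by (simp add: N_def)
  qed
  have Nin: "norm (fst z) < R" "\<delta> < snd z" "snd z \<le> t\<^sub>0" if "z \<in> N" for z
  proof -
    have "0 < 1 / (K * M)" "0 < B / M" using K B \<open>M > 0\<close> by auto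
    moreover have "1 / (K * M) \<le> snd z - \<delta>" "B / M \<le> (R\<^sup>2 - (norm (fst z))\<^sup>2)\<^sup>2"
      using that by (simp_all add: N_def)
    ultimately have "0 < snd z - \<delta>" "0 < (R\<^sup>2 - (norm (fst z))\<^sup>2)\<^sup>2" by linarith+
    then show "\<delta> < snd z" "norm (fst z) < R" "snd z \<le> t\<^sub>0"
      using that by (auto simp: N_def C_def less_le)
  qed
  have "N \<subseteq> C" by (simp add: N_def)
  have nz: "K * (snd z - \<delta>) \<noteq> 0" "(R\<^sup>2 - (norm (fst z))\<^sup>2)\<^sup>2 \<noteq> 0" if "z \<in> N" for z
    using K Nin(2)[OF that] \<rho>pos[OF Nin(1)[OF that]] by auto
  have "continuous_on N W"
    unfolding W_def P_def
    by (intro continuous_intros continuous_on_subset[OF contH] ballI nz \<open>N \<subseteq> C\<close>)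
  moreover have "N \<noteq> {}" using inN[of "(x\<^sub>0, t\<^sub>0)"] x0 \<delta> neg by auto
  ultimately obtain w where w: "w \<in> N" "\<And>z. z \<in> N \<Longrightarrow> W w \<le> W z"
    using continuous_attains_inf[OF \<open>compact N\<close>] by blast
  have "W w < 0" using w(2)[of "(x\<^sub>0, t\<^sub>0)"] inN[of "(x\<^sub>0, t\<^sub>0)"] x0 \<delta> neg by auto
  \<comment> \<open>Minimality extends from \<open>N\<close> to the whole cylinder: off
    \<open>N\<close> the function \<open>W\<close> is nonnegative, while \<open>W w\<close> is
    negative.\<close>
  have wmin: "W w \<le> W z" if "norm (fst z) < R" "\<delta> < snd z" "snd z \<le> t\<^sub>0" for z
    using inN[OF that] w(2)[of z] \<open>W w < 0\<close> by linarith
  obtain x t where w_eq: "w = (x, t)" by (cases w)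
  have x: "norm x < R" and t: "\<delta> < t" "t \<le> t\<^sub>0" using Nin[OF w(1)] by (auto simp: w_eq)
  have wS: "w \<in> S" using t \<delta> by (simp add: S w_eq)
  define \<rho> where "\<rho> = R\<^sup>2 - (norm x)\<^sup>2"
  have "\<rho> > 0" using \<rho>pos[OF x] by (simp add: \<rho>_def)
  define \<tau> where "\<tau> = t - \<delta>"
  have "\<tau> > 0" using t by (simp add: \<tau>_def)
  define \<psi> where "\<psi> = B / \<rho>\<^sup>2"
  have "\<psi> > 0" using B \<open>\<rho> > 0\<close> by (simp add: \<psi>_def)

  \<comment> \<open>Only earlier times are compared, as \<open>t\<close> may equal
    \<open>t\<^sub>0\<close>; the time barrier has derivative -1 / (K \<tau>^2).\<close>
  have dt: "dt ?H w \<le> 1 / (K * \<tau>\<^sup>2)"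
  proof -
    have "((\<lambda>s. ?H (w + s *\<^sub>R (0, 1))) has_real_derivative dt ?H (w + 0 *\<^sub>R (0, 1))) (at 0)"
      using wS by (intro smooth_on_line_deriv[OF smooth_harnack open_S]) (simp add: w_eq)
    moreover have "((\<lambda>s. 1 / K / (t + s - \<delta>) ^ 1 + \<psi>) has_real_derivative
        0 / (t + 0 - \<delta>) ^ 1 - real 1 * (1 / K) * 1 / (t + 0 - \<delta>) ^ Suc 1 + 0) (at 0)"
      using t by (intro DERIV_add DERIV_divide_power) (auto intro!: derivative_eq_intros)
    then have "((\<lambda>s. 1 / (K * (t + s - \<delta>)) + \<psi>) has_real_derivative - 1 / (K * \<tau>\<^sup>2)) (at 0)"
      by (simp add: \<tau>_def power2_eq_square)
    ultimately have "((\<lambda>s. ?H (w + s *\<^sub>R (0, 1)) + (1 / (K * (t + s - \<delta>)) + \<psi>)) has_real_derivative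
        dt ?H (w + 0 *\<^sub>R (0, 1)) + - 1 / (K * \<tau>\<^sup>2)) (at 0)"
      by (rule DERIV_add)
    then have "dt ?H (w + 0 *\<^sub>R (0, 1)) + - 1 / (K * \<tau>\<^sup>2) \<le> 0"
    proof (rule left_derivative_test[OF \<open>\<tau> > 0\<close>])
      fix s :: real assume "0 - \<tau> < s" "s \<le> 0"
      then have "W w \<le> W (x, t + s)" using x t by (intro wmin) (auto simp: \<tau>_def)
      then show "?H (w + 0 *\<^sub>R (0, 1)) + (1 / (K * (t + 0 - \<delta>)) + \<psi>)
          \<le> ?H (w + s *\<^sub>R (0, 1)) + (1 / (K * (t + s - \<delta>)) + \<psi>)"
        by (simp add: W_def P_def w_eq \<psi>_def \<rho>_def)
    qed
    then show ?thesis by (simp add: w_eq)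
  qed

  \<comment> \<open>Along the i-th axis R^2 - |x|^2 becomes
    \<open>\<rho> - 2 * s * x $ i - s\<^sup>2\<close>. At the minimum the derivatives of H balance
    those of the barrier to first order and dominate their negatives to second order.\<close>
  have dx: "dx i ?H w = - (4 * B * x $ i / \<rho>^3)"
    and dxx: "dx i (dx i ?H) w \<ge> - (4 * B / \<rho>^3 + 24 * B * (x $ i)\<^sup>2 / \<rho>^4)" for i
  proof -
    let ?v = "(axis i 1, 0) :: (real^'n) \<times> real"
    define e where "e = R - norm x"
    have "e > 0" using x by (simp add: e_def)
    have near: "norm (x + s *\<^sub>R axis i 1) < R" if "\<bar>s\<bar> < e" for s
      using norm_triangle_ineq[of x "s *\<^sub>R axis i 1"] that by (simp add: e_def)
    have pos: "\<rho> - 2 * s * x $ i - s\<^sup>2 > 0" if "\<bar>s\<bar> < e" for s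
      using \<rho>pos[OF near[OF that]] by (simp add: norm_add_axis_sq \<rho>_def)
    let ?F = "\<lambda>s. ?H (w + s *\<^sub>R ?v) + (1 / (K * \<tau>) + B / (\<rho> - 2 * s * x $ i - s\<^sup>2)\<^sup>2)"
    let ?F' = "\<lambda>s. dx i ?H (w + s *\<^sub>R ?v) + 4 * B * (x $ i + s) / (\<rho> - 2 * s * x $ i - s\<^sup>2)^3"
    have inS: "w + s *\<^sub>R ?v \<in> S" for s using wS by (simp add: S w_eq)
    have F: "(?F has_real_derivative ?F' s) (at s)" if "\<bar>s\<bar> < e" for s
    proof (rule DERIV_add)
      show "((\<lambda>s. ?H (w + s *\<^sub>R ?v)) has_real_derivative dx i ?H (w + s *\<^sub>R ?v)) (at s)"
        by (intro smooth_on_line_deriv[OF smooth_harnack open_S] inS)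
      have "((\<lambda>s. 1 / (K * \<tau>) + B / (\<rho> - 2 * s * x $ i - s\<^sup>2)\<^sup>2) has_real_derivative
          0 + (0 / (\<rho> - 2 * s * x $ i - s\<^sup>2)\<^sup>2
            - real 2 * B * (- 2 * x $ i - 2 * s) / (\<rho> - 2 * s * x $ i - s\<^sup>2) ^ Suc 2)) (at s)"
        using pos[OF that]
        by (intro DERIV_add DERIV_divide_power DERIV_const) (auto intro!: derivative_eq_intros)
      also have "0 + (0 / (\<rho> - 2 * s * x $ i - s\<^sup>2)\<^sup>2
          - real 2 * B * (- 2 * x $ i - 2 * s) / (\<rho> - 2 * s * x $ i - s\<^sup>2) ^ Suc 2)
          = - (real 2 * B * (- 2 * x $ i - 2 * s)) / (\<rho> - 2 * s * x $ i - s\<^sup>2) ^ 3"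
        by (simp add: eval_nat_numeral)
      also have "- (real 2 * B * (- 2 * x $ i - 2 * s)) = 4 * B * (x $ i + s)" by (simp add: algebra_simps)
      finally show "((\<lambda>s. 1 / (K * \<tau>) + B / (\<rho> - 2 * s * x $ i - s\<^sup>2)\<^sup>2) has_real_derivative
          4 * B * (x $ i + s) / (\<rho> - 2 * s * x $ i - s\<^sup>2)^3) (at s)" .
    qed
    have F': "(?F' has_real_derivative
        dx i (dx i ?H) (w + 0 *\<^sub>R ?v) + (4 * B / \<rho>^3 + 24 * B * (x $ i)\<^sup>2 / \<rho>^4)) (at 0)"
    proof (rule DERIV_add)
      show "((\<lambda>s. dx i ?H (w + s *\<^sub>R ?v)) has_real_derivative dx i (dx i ?H) (w + 0 *\<^sub>R ?v)) (at 0)"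
        by (intro smooth_on_line_deriv[OF smooth_dir[OF smooth_harnack] open_S] inS)
      have "((\<lambda>s. 4 * B * (x $ i + s) / (\<rho> - 2 * s * x $ i - s\<^sup>2)^3) has_real_derivative
          4 * B / (\<rho> - 2 * 0 * x $ i - 0\<^sup>2) ^ 3
            - real 3 * (4 * B * (x $ i + 0)) * (- 2 * x $ i) / (\<rho> - 2 * 0 * x $ i - 0\<^sup>2) ^ Suc 3) (at 0)"
        using \<open>\<rho> > 0\<close> by (intro DERIV_divide_power) (auto intro!: derivative_eq_intros)
      then show "((\<lambda>s. 4 * B * (x $ i + s) / (\<rho> - 2 * s * x $ i - s\<^sup>2)^3) has_real_derivative
          4 * B / \<rho>^3 + 24 * B * (x $ i)\<^sup>2 / \<rho>^4) (at 0)"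
        by (simp add: power2_eq_square mult.assoc)
    qed
    have Fmin: "?F 0 \<le> ?F s" if "\<bar>s\<bar> < e" for s
    proof -
      have "W w \<le> W (x + s *\<^sub>R axis i 1, t)" using near[OF that] t by (intro wmin) auto
      then show ?thesis by (simp add: W_def P_def w_eq \<tau>_def \<rho>_def norm_add_axis_sq algebra_simps)
    qed
    from second_derivative_test[OF \<open>e > 0\<close> F F' Fmin]
    show "dx i ?H w = - (4 * B * x $ i / \<rho>^3)"
      "dx i (dx i ?H) w \<ge> - (4 * B / \<rho>^3 + 24 * B * (x $ i)\<^sup>2 / \<rho>^4)" by (simp_all add: w_eq)
  qed

  \<comment> \<open>Upper bound for L H at the minimum\<close>
  have g: "grad_sq w \<ge> 0" by (simp add: grad_sq_def sum_nonneg)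
  have norm_sq: "(\<Sum>i\<in>UNIV. (x $ i)\<^sup>2) = (norm x)\<^sup>2"
    by (simp add: norm_vec_def L2_set_def sum_nonneg)
  \<comment> \<open>The barrier term of \<open>(\<beta> |\<nabla>u|\<^sup>2 + h)\<^sup>2\<close> that is linear in \<open>|\<nabla>u|\<^sup>2\<close> absorbs the drift; this needs \<open>\<beta> > 0\<close>.\<close>
  have young: "- 2 * (dx i u w * dx i ?H w) \<le> 2 * K * \<beta> * \<psi> * (dx i u w)\<^sup>2 + 8 / (K * \<beta>) * B / \<rho>^4 * (x $ i)\<^sup>2" for i
  proof -
    have "0 \<le> 2 * B / (K * \<beta> * \<rho>^4) * (K * \<beta> * \<rho> * dx i u w - 2 * x $ i)\<^sup>2"
      using K B \<open>\<beta> > 0\<close> \<open>\<rho> > 0\<close> by simp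
    also have "\<dots> = 2 * K * \<beta> * \<psi> * (dx i u w)\<^sup>2 + 8 / (K * \<beta>) * B / \<rho>^4 * (x $ i)\<^sup>2 + 2 * (dx i u w * dx i ?H w)"
      using K \<open>\<beta> > 0\<close> \<open>\<rho> > 0\<close> unfolding dx \<psi>_def
      by (simp add: field_simps) (simp add: eval_nat_numeral algebra_simps)
    finally show ?thesis by simp
  qed
  have "L ?H w \<le> 1 / (K * \<tau>\<^sup>2) + (\<Sum>i\<in>UNIV. 4 * B / \<rho>^3 + 24 * B * (x $ i)\<^sup>2 / \<rho>^4)
      + (\<Sum>i\<in>UNIV. 2 * K * \<beta> * \<psi> * (dx i u w)\<^sup>2 + 8 / (K * \<beta>) * B / \<rho>^4 * (x $ i)\<^sup>2)"
  proof -
    have "- dx i (dx i ?H) w \<le> 4 * B / \<rho>^3 + 24 * B * (x $ i)\<^sup>2 / \<rho>^4" for i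
      using dxx[of i] by linarith
    then have "- (\<Sum>i\<in>UNIV. dx i (dx i ?H) w) \<le> (\<Sum>i\<in>UNIV. 4 * B / \<rho>^3 + 24 * B * (x $ i)\<^sup>2 / \<rho>^4)"
      unfolding sum_negf[symmetric] by (intro sum_mono)
    moreover have "- 2 * (\<Sum>i\<in>UNIV. dx i u w * dx i ?H w)
        \<le> (\<Sum>i\<in>UNIV. 2 * K * \<beta> * \<psi> * (dx i u w)\<^sup>2 + 8 / (K * \<beta>) * B / \<rho>^4 * (x $ i)\<^sup>2)"
      unfolding sum_distrib_left by (intro sum_mono young)
    ultimately show ?thesis using dt unfolding L_def by linarith
  qed
  also have "\<dots> = 1 / (K * \<tau>\<^sup>2) + 2 * K * \<beta> * \<psi> * grad_sq w
      + (4 * real CARD('n) * \<rho> + 24 * (norm x)\<^sup>2 + 8 / (K * \<beta>) * (norm x)\<^sup>2) * (B / \<rho>^4)"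
  proof -
    have "4 * B / \<rho>^3 = 4 * \<rho> * (B / \<rho>^4)"
      using \<open>\<rho> > 0\<close> by (simp add: eval_nat_numeral)
    then have "(\<Sum>i\<in>UNIV. 4 * B / \<rho>^3 + 24 * B * (x $ i)\<^sup>2 / \<rho>^4)
        = (\<Sum>i\<in>(UNIV::'n set). 4 * \<rho> * (B / \<rho>^4)) + 24 * (B / \<rho>^4) * (norm x)\<^sup>2"
      unfolding norm_sq[symmetric] sum_distrib_left sum.distrib[symmetric] by (intro sum.cong) auto
    moreover have "(\<Sum>i\<in>UNIV. 2 * K * \<beta> * \<psi> * (dx i u w)\<^sup>2 + 8 / (K * \<beta>) * B / \<rho>^4 * (x $ i)\<^sup>2)
        = 2 * K * \<beta> * \<psi> * grad_sq w + 8 / (K * \<beta>) * (B / \<rho>^4) * (norm x)\<^sup>2"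
      unfolding norm_sq[symmetric] grad_sq_def sum_distrib_left sum.distrib[symmetric] by (intro sum.cong) auto
    ultimately show ?thesis by (simp only: sum_constant distrib_right) (simp add: mult_ac)
  qed
  \<comment> \<open>Both \<open>\<rho>\<close> and the squared norm of \<open>x\<close> are at most
    \<open>R\<^sup>2\<close>, so the size condition on \<open>B\<close> applies. The result is the
    spatial part \<open>K * \<psi>\<^sup>2\<close> of the square below.\<close>
  also have "(4 * real CARD('n) * \<rho> + 24 * (norm x)\<^sup>2 + 8 / (K * \<beta>) * (norm x)\<^sup>2) * (B / \<rho>^4)
      \<le> (K * B) * (B / \<rho>^4)"
  proof (rule mult_right_mono)
    have *: "\<rho> \<le> R\<^sup>2" "(norm x)\<^sup>2 \<le> R\<^sup>2" using \<open>\<rho> > 0\<close> by (auto simp: \<rho>_def)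
    have "4 * real CARD('n) * \<rho> + 24 * (norm x)\<^sup>2 + 8 / (K * \<beta>) * (norm x)\<^sup>2
        \<le> 4 * real CARD('n) * R\<^sup>2 + 24 * R\<^sup>2 + 8 / (K * \<beta>) * R\<^sup>2"
      using K \<open>\<beta> > 0\<close> by (intro add_mono mult_left_mono *) auto
    also have "\<dots> \<le> K * B" using B(2) by (simp add: algebra_simps)
    finally show "4 * real CARD('n) * \<rho> + 24 * (norm x)\<^sup>2 + 8 / (K * \<beta>) * (norm x)\<^sup>2 \<le> K * B" .
  qed (use B in auto)
  also have "(K * B) * (B / \<rho>^4) = K * \<psi>\<^sup>2"
    by (simp add: \<psi>_def power_divide power2_eq_square eval_nat_numeral)
  finally have upper: "L ?H w \<le> 1 / (K * \<tau>\<^sup>2) + 2 * K * \<beta> * \<psi> * grad_sq w + K * \<psi>\<^sup>2" by simp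

  \<comment> \<open>Contradiction with the lower bound\<close>
  define h where "h = 1 / (K * \<tau>) + \<psi>"
  have "h \<ge> 0" using K \<open>\<tau> > 0\<close> \<open>\<psi> > 0\<close> by (simp add: h_def)
  have "?H w \<le> - h"
    using \<open>W w < 0\<close> by (simp add: W_def P_def h_def w_eq \<tau>_def \<psi>_def \<rho>_def)
  then have lower: "K * (\<beta> * grad_sq w + h)\<^sup>2 \<le> L ?H w"
    using assms wS \<open>h \<ge> 0\<close> by (intro L_harnack_ge[where c = c]) auto
  \<comment> \<open>Every term of the upper bound occurs in the expanded square; among the leftover
    cross terms \<open>2 * \<psi> / \<tau>\<close> is strictly positive.\<close>
  have "K * (\<beta> * grad_sq w + h)\<^sup>2 - (1 / (K * \<tau>\<^sup>2) + 2 * K * \<beta> * \<psi> * grad_sq w + K * \<psi>\<^sup>2)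
      = K * (\<beta> * grad_sq w)\<^sup>2 + 2 * \<beta> * grad_sq w / \<tau> + 2 * \<psi> / \<tau>"
    using K \<open>\<tau> > 0\<close> by (simp add: h_def field_simps power2_eq_square)
  moreover have "K * (\<beta> * grad_sq w)\<^sup>2 + 2 * \<beta> * grad_sq w / \<tau> \<ge> 0" "2 * \<psi> / \<tau> > 0"
    using K \<open>\<tau> > 0\<close> g \<open>\<beta> > 0\<close> \<open>\<psi> > 0\<close> by auto
  ultimately show False using lower upper by linarith
qed

text \<open>One parameter drives both limits: \<delta> = \<epsilon> and R^2 = 1 / \<epsilon>. With B
  = C R^2 the spatial barrier at a fixed \<open>x\<close> is of order \<epsilon> and
  vanishes.\<close>

lemma harnack_nonneg:
  assumes S: "S = UNIV \<times> {0<..}"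
    and E: "\<And>z. z \<in> S \<Longrightarrow> E z \<ge> 0" and "q \<ge> 0" and "\<alpha> > \<beta>" "\<beta> > 0"
    and c: "c * (q + 1) \<le> \<alpha> * q + 2 * \<beta>"
    and quad: "\<And>s e. 0 \<le> s \<Longrightarrow> 0 \<le> e \<Longrightarrow>
      K * s\<^sup>2 \<le> 2 * (\<alpha> - \<beta>) / (real CARD('n) * \<alpha>\<^sup>2) * (s + c * e)\<^sup>2 - q * e * (s + c * e) + q * c * e\<^sup>2"
    and K: "K > 0" and t: "t > 0"
  shows "0 \<le> harnack \<alpha> \<beta> c (x, t) + 1 / (K * t)"
proof -
  \<comment> \<open>Chosen so that B = C R^2 satisfies the size condition of
    \<open>harnack_barrier\<close> with equality.\<close>
  define C where "C = (4 * real CARD('n) + 24 + 8 / (K * \<beta>)) / K"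
  have "C > 0" using K \<open>\<beta> > 0\<close> by (simp add: C_def add_pos_pos)
  have CK: "4 * real CARD('n) + 24 + 8 / (K * \<beta>) = K * C" using K by (simp add: C_def)
  show ?thesis
  proof (rule tendsto_lowerbound)
    let ?Q = "\<lambda>\<epsilon>. harnack \<alpha> \<beta> c (x, t) + (1 / (K * (t - \<epsilon>)) + C * \<epsilon> / (1 - \<epsilon> * (norm x)\<^sup>2)\<^sup>2)"
    have "(?Q \<longlongrightarrow> harnack \<alpha> \<beta> c (x, t) + (1 / (K * (t - 0)) + C * 0 / (1 - 0 * (norm x)\<^sup>2)\<^sup>2)) (at_right 0)"
      using K t by (intro tendsto_intros) auto
    then show "(?Q \<longlongrightarrow> harnack \<alpha> \<beta> c (x, t) + 1 / (K * t)) (at_right 0)"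
      by simp
    \<comment> \<open>This bound on \<epsilon> places \<open>x\<close> inside the ball of radius R;
      the bound by \<open>t\<close> gives \<delta> < t.\<close>
    have "1 / (1 + (norm x)\<^sup>2) > 0" by (simp add: add_pos_nonneg)
    with t have "min t (1 / (1 + (norm x)\<^sup>2)) > 0" by simp
    from eventually_at_right_real[OF this]
    show "\<forall>\<^sub>F \<epsilon> in at_right 0. 0 \<le> ?Q \<epsilon>"
    proof eventually_elim
      case (elim \<epsilon>)
      then have \<epsilon>: "0 < \<epsilon>" "\<epsilon> < t" "\<epsilon> < 1 / (1 + (norm x)\<^sup>2)" by auto
      define R where "R = 1 / sqrt \<epsilon>"
      have R: "R > 0" "R\<^sup>2 = 1 / \<epsilon>" using \<epsilon> by (auto simp: R_def power_divide)
      have "\<epsilon> * (1 + (norm x)\<^sup>2) < 1"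
        using \<epsilon>(3) by (simp add: pos_less_divide_eq add_pos_nonneg)
      then have x: "\<epsilon> * (norm x)\<^sup>2 < 1" using \<epsilon>(1) by (simp add: algebra_simps)
      then have "(norm x)\<^sup>2 < R\<^sup>2" using \<epsilon>(1) by (simp add: R field_simps)
      then have "norm x < R" using R(1) by (simp add: power_less_imp_less_base)
      then have "0 \<le> harnack \<alpha> \<beta> c (x, t) + (1 / (K * (t - \<epsilon>)) + (C * R\<^sup>2) / (R\<^sup>2 - (norm x)\<^sup>2)\<^sup>2)"
        using K \<open>C > 0\<close> R(1) \<epsilon> CK
        by (intro harnack_barrier[where c = c and K = K] assms) auto
      also have "(C * R\<^sup>2) / (R\<^sup>2 - (norm x)\<^sup>2)\<^sup>2 = C * \<epsilon> / (1 - \<epsilon> * (norm x)\<^sup>2)\<^sup>2"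
      proof -
        have "R\<^sup>2 - (norm x)\<^sup>2 = (1 - \<epsilon> * (norm x)\<^sup>2) / \<epsilon>"
          unfolding R using \<epsilon>(1) by (simp add: field_simps)
        then show ?thesis
          unfolding R(2) using \<epsilon>(1) by (simp add: power_divide power2_eq_square)
      qed
      finally show ?case .
    qed
  qed simp
qed

end

subsection \<open>The Harnack estimate\<close>

lemma partial_eq_dx:
  fixes G :: "(real^'n::finite) \<times> real \<Rightarrow> real"
  assumes "smooth_on S G" "open S" "(x, t) \<in> S"
  shows "partial i (\<lambda>y. G (y, t)) x = dx i G (x, t)"
proof -
  have "((\<lambda>s. G ((x, t) + s *\<^sub>R (axis i 1, 0))) has_real_derivative dx i G ((x, t) + 0 *\<^sub>R (axis i 1, 0))) (at 0)"
    using assms by (intro smooth_on_line_deriv) auto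
  then show ?thesis unfolding partial_def by (intro DERIV_imp_deriv) simp
qed

text \<open>Since \<open>partial\<close> is iterated, the first derivatives must be identified on
  the whole time slice; hence the assumption for all \<open>y\<close>.\<close>

lemma laplacian_eq_dx:
  fixes G :: "(real^'n::finite) \<times> real \<Rightarrow> real"
  assumes G: "smooth_on S G" "open S" and t: "\<And>y. (y, t) \<in> S"
  shows "laplacian (\<lambda>y. G (y, t)) x = (\<Sum>i\<in>UNIV. dx i (dx i G) (x, t))"
proof -
  have "partial i (\<lambda>y. G (y, t)) = (\<lambda>y. dx i G (y, t))" for i
    using partial_eq_dx[OF G t] by blast
  then show ?thesis
    unfolding laplacian_def using partial_eq_dx[OF smooth_on_dir_deriv[OF G] G(2) t] by simp
qed

text \<open>From \<nabla>F = F \<nabla>u follows \<Delta>F = F (\<Delta>u + |\<nabla>u|^2); dividing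
  the equation for \<open>F\<close> by \<open>F\<close> gives the evolution of
  \<open>u\<close>.\<close>

lemma log_heat_ln:
  fixes F :: "(real^'n::finite) \<times> real \<Rightarrow> real"
  assumes S: "open S" and F: "smooth_on S F" and pos: "\<And>z. z \<in> S \<Longrightarrow> F z > 0"
    and eq: "\<And>z. z \<in> S \<Longrightarrow> dt F z = (\<Sum>i\<in>UNIV. dx i (dx i F) z) + F z powr p"
  shows "log_heat (\<lambda>z. ln (F z)) (\<lambda>z. F z powr (p - 1)) (p - 1) S"
proof
  let ?u = "\<lambda>z. ln (F z)" and ?E = "\<lambda>z. F z powr (p - 1)"
  show "open S" by (rule S)
  show u: "smooth_on S ?u" using pos F by (rule smooth_on_ln)
  show "smooth_on S ?E" using pos F by (rule smooth_on_powr)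
  have dF: "F z * dir_deriv v ?u z = dir_deriv v F z" if "z \<in> S" for z v
    using dir_deriv_compose[OF F S that DERIV_ln[OF pos[OF that]]] pos[OF that] by simp
  show "dir_deriv v ?E z = (p - 1) * ?E z * dir_deriv v ?u z" if "z \<in> S" for z v
  proof -
    have "F z powr (p - 1 - 1) * F z = ?E z"
      using pos[OF that] powr_add[of "F z" "p - 1 - 1" 1] by simp
    then show ?thesis
      using dir_deriv_compose[OF F S that has_real_derivative_powr[OF pos[OF that], of "p - 1"]]
      by (simp add: dF[OF that, symmetric] ac_simps)
  qed
  show "dt ?u z = (\<Sum>i\<in>UNIV. dx i (dx i ?u) z) + (\<Sum>i\<in>UNIV. (dx i ?u z)\<^sup>2) + ?E z" if z: "z \<in> S" for z
  proof -
    have "dx i (dx i F) z = F z * (dx i (dx i ?u) z + (dx i ?u z)\<^sup>2)" for i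
    proof -
      have "dx i (dx i F) z = dx i (\<lambda>z. F z * dx i ?u z) z"
        by (rule dir_deriv_cong[OF S z]) (simp add: dF)
      also have "\<dots> = F z * dx i (dx i ?u) z + dx i F z * dx i ?u z"
        by (rule dir_deriv_mult[OF F smooth_on_dir_deriv[OF u S] S z])
      finally show ?thesis by (simp add: dF[OF z, symmetric] algebra_simps power2_eq_square)
    qed
    moreover have "F z powr p = F z * ?E z"
      using pos[OF z] powr_add[of "F z" 1 "p - 1"] by simp
    ultimately have "F z * dt ?u z
        = F z * ((\<Sum>i\<in>UNIV. dx i (dx i ?u) z) + (\<Sum>i\<in>UNIV. (dx i ?u z)\<^sup>2) + ?E z)"
      using eq[OF z] by (simp add: dF[OF z] sum.distrib sum_distrib_left algebra_simps)
    then show ?thesis using pos[OF z] by simp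
  qed
qed

theorem theorem2p2:
  fixes f :: "real^'n \<Rightarrow> real \<Rightarrow> real" and f0 :: "real^'n \<Rightarrow> real"
    and p \<alpha> \<beta> a c :: real
  assumes p_gt: "p > 1"
    and smooth: "smooth_on (UNIV \<times> {0..}) (\<lambda>z. f (fst z) (snd z))"
    and pos: "\<And>x t. t \<ge> 0 \<Longrightarrow> f x t > 0"
    and pde: "\<And>x t. t \<ge> 0 \<Longrightarrow>
        ((\<lambda>s. f x s) has_real_derivative (laplacian (\<lambda>y. f y t) x + f x t powr p))
          (at t within {0..})"
    and init: "\<And>x. f x 0 = f0 x"
    and ab: "\<alpha> > \<beta>" "\<beta> \<ge> 0"
    and c_up: "(\<alpha> * (p - 1) + 2 * \<beta>) / p \<ge> c"
    and c_lo: "c \<ge> (p - 1) * real CARD('n) * \<alpha>\<^sup>2 / (4 * (\<alpha> - \<beta>))"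
    and a_lo: "a \<ge> real CARD('n) * \<alpha>\<^sup>2 / (2 * (\<alpha> - \<beta>))"
    and a_pos: "real CARD('n) * \<alpha>\<^sup>2 / (2 * (\<alpha> - \<beta>)) > 0"
  shows "\<forall>x. \<forall>t>0.
    \<alpha> * laplacian (\<lambda>y. ln (f y t)) x + \<beta> * grad_norm_sq (\<lambda>y. ln (f y t)) x
      + c * exp (ln (f x t) * (p - 1)) + a / t \<ge> 0"
proof (intro allI impI)
  fix x :: "real^'n" and t :: real
  assume t: "t > 0"
  \<comment> \<open>Positive times form an open set, on which the one-sided derivatives of the
    hypotheses become ordinary ones.\<close>
  define S where "S = (UNIV :: (real^'n) set) \<times> {0::real<..}"
  define F where "F z = f (fst z) (snd z)" for z
  define u where "u z = ln (F z)" for z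
  define E where "E z = F z powr (p - 1)" for z
  have S: "open S" by (simp add: S_def open_Times)
  have F: "smooth_on S F"
    unfolding F_def[abs_def] by (rule smooth_on_subset[OF smooth]) (auto simp: S_def)
  have Fpos: "F z > 0" if "z \<in> S" for z
    using that pos by (auto simp: F_def S_def)
  have inS: "(y, t) \<in> S" if "t > 0" for y t using that by (simp add: S_def)
  have "dt F z = (\<Sum>i\<in>UNIV. dx i (dx i F) z) + F z powr p" if z: "z \<in> S" for z
  proof -
    obtain y s where z_eq: "z = (y, s)" and s: "s > 0" using z by (auto simp: S_def)
    have "at s within {0..} = at s" using s by (intro at_within_interior) simp
    then have "(f y has_real_derivative (laplacian (\<lambda>y. F (y, s)) y + F z powr p)) (at s)"
      using pde[of s y] s by (simp add: F_def z_eq)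
    moreover have "((\<lambda>r. F ((y, 0) + r *\<^sub>R (0, 1))) has_real_derivative dt F ((y, 0) + s *\<^sub>R (0, 1))) (at s)"
      using inS[OF s] by (intro smooth_on_line_deriv[OF F S]) simp
    then have "(f y has_real_derivative dt F z) (at s)"
      by (simp add: F_def z_eq)
    ultimately have "laplacian (\<lambda>y. F (y, s)) y + F z powr p = dt F z" by (rule DERIV_unique)
    then show ?thesis
      using laplacian_eq_dx[OF F S inS[OF s]] z_eq by simp
  qed
  with S F Fpos interpret log_heat u E "p - 1" S
    unfolding u_def[abs_def] E_def[abs_def] by (rule log_heat_ln)
  have lap_eq: "laplacian (\<lambda>y. ln (f y t)) x = lap (x, t)"
    using laplacian_eq_dx[OF smooth_u S inS[OF t]] by (simp add: lap_def u_def F_def)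
  have g_eq: "grad_norm_sq (\<lambda>y. ln (f y t)) x = grad_sq (x, t)"
    using partial_eq_dx[OF smooth_u S inS[OF t]] by (simp add: grad_norm_sq_def grad_sq_def u_def F_def)
  have E_eq: "exp (ln (f x t) * (p - 1)) = E (x, t)"
    using pos[of t x] t by (simp add: E_def F_def powr_def mult.commute)

  \<comment> \<open>Raising \<open>\<beta>\<close> to \<open>\<beta>'\<close> can violate the lower bound on \<open>c\<close>. The term \<open>k c\<^sup>2 E\<^sup>2\<close>, which the case \<open>\<beta>' = \<beta>\<close>
    does not use, pays for it at the price of replacing \<open>k\<close> by \<open>k (2 - 1 / \<kappa>)\<close>.\<close>
  define k where "k = 2 * (\<alpha> - \<beta>) / (real CARD('n) * \<alpha>\<^sup>2)"
  have "\<alpha> > 0" using ab by simp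
  then have "k > 0" using ab by (simp add: k_def)
  \<comment> \<open>The lower bound on \<open>c\<close>, restated as the inequality between the
    mixed coefficients of s e in the quadratic form.\<close>
  have qc: "p - 1 \<le> 2 * k * c"
    using c_lo ab \<open>\<alpha> > 0\<close> by (simp add: k_def field_simps)
  have ka: "1 / k \<le> a" using a_lo by (simp add: k_def)
  let ?Q = "\<lambda>\<kappa>. \<alpha> * lap (x, t) + ((\<beta> + (1 - \<kappa>) * (\<alpha> - \<beta>)) * grad_sq (x, t) + c * E (x, t)) + 1 / (k * (2 - 1 / \<kappa>) * t)"
  \<comment> \<open>The new parameter satisfies \<alpha> - \<beta>' = \<kappa> (\<alpha> - \<beta>),
    which replaces k by \<kappa> k in the quadratic form; \<kappa> > 1/2 keeps 2 - 1 / \<kappa>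
    positive.\<close>
  have "0 \<le> ?Q \<kappa>" if \<kappa>: "1/2 < \<kappa>" "\<kappa> < 1" for \<kappa>
  proof -
    define \<beta>' where "\<beta>' = \<beta> + (1 - \<kappa>) * (\<alpha> - \<beta>)"
    have diff: "\<alpha> - \<beta>' = \<kappa> * (\<alpha> - \<beta>)" by (simp add: \<beta>'_def algebra_simps)
    have "\<beta>' > \<beta>" using \<kappa> ab by (simp add: \<beta>'_def)
    have "\<kappa> * (\<alpha> - \<beta>) > 0" using \<kappa> ab by simp
    then have "\<beta>' < \<alpha>" using diff by linarith
    have "0 \<le> harnack \<alpha> \<beta>' c (x, t) + 1 / (k * (2 - 1 / \<kappa>) * t)"
    proof (rule harnack_nonneg[OF S_def])
      show "c * (p - 1 + 1) \<le> \<alpha> * (p - 1) + 2 * \<beta>'"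
        using c_up p_gt \<open>\<beta>' > \<beta>\<close> by (simp add: field_simps)
      show "k * (2 - 1 / \<kappa>) > 0" using \<kappa> \<open>k > 0\<close> by (simp add: field_simps)
      show "k * (2 - 1 / \<kappa>) * s\<^sup>2 \<le> 2 * (\<alpha> - \<beta>') / (real CARD('n) * \<alpha>\<^sup>2) * (s + c * e)\<^sup>2
          - (p - 1) * e * (s + c * e) + (p - 1) * c * e\<^sup>2" if "0 \<le> s" "0 \<le> e" for s e
      proof -
        have k': "2 * (\<alpha> - \<beta>') / (real CARD('n) * \<alpha>\<^sup>2) = \<kappa> * k" by (simp add: diff k_def)
        \<comment> \<open>With K = k (2 - 1 / \<kappa>) the form with mixed coefficient 2 k c leaves
          exactly this square; \<open>qc\<close> then passes to the coefficient p - 1.\<close>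
        have "0 \<le> k / \<kappa> * (\<kappa> * (c * e) - (1 - \<kappa>) * s)\<^sup>2" using \<kappa> \<open>k > 0\<close> by simp
        also have "\<dots> = \<kappa> * k * (s + c * e)\<^sup>2 - 2 * k * c * e * s - k * (2 - 1 / \<kappa>) * s\<^sup>2"
          using \<kappa> by (simp add: field_simps power2_eq_square)
        also have "\<dots> \<le> \<kappa> * k * (s + c * e)\<^sup>2 - (p - 1) * e * s - k * (2 - 1 / \<kappa>) * s\<^sup>2"
          using mult_right_mono[OF qc, of "e * s"] that by (simp add: mult.assoc)
        finally show ?thesis unfolding k' by (simp add: algebra_simps power2_eq_square)
      qed
    qed (use p_gt ab t \<open>\<beta>' > \<beta>\<close> \<open>\<beta>' < \<alpha>\<close> in \<open>auto simp: E_def\<close>)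
    then show ?thesis by (simp add: harnack_def \<beta>'_def)
  qed
  \<comment> \<open>As \<kappa> tends to 1 from below, \<beta>' returns to \<beta> and the time
    constant becomes 1 / k, which is at most \<open>a\<close>.\<close>
  then have "\<forall>\<^sub>F \<kappa> in at_left 1. 0 \<le> ?Q \<kappa>"
    using eventually_at_left_real[of "1/2" 1] by (auto elim!: eventually_mono)
  moreover have "(?Q \<longlongrightarrow> \<alpha> * lap (x, t) + ((\<beta> + (1 - 1) * (\<alpha> - \<beta>)) * grad_sq (x, t) + c * E (x, t)) + 1 / (k * (2 - 1 / 1) * t)) (at_left 1)"
    using \<open>k > 0\<close> t by (intro tendsto_intros) auto
  ultimately have "0 \<le> \<alpha> * lap (x, t) + (\<beta> * grad_sq (x, t) + c * E (x, t)) + 1 / (k * t)"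
    by (intro tendsto_lowerbound[where F = "at_left (1::real)" and f = ?Q]) auto
  moreover have "1 / (k * t) \<le> a / t"
    using divide_right_mono[OF ka, of t] t by simp
  ultimately show "0 \<le> \<alpha> * laplacian (\<lambda>y. ln (f y t)) x + \<beta> * grad_norm_sq (\<lambda>y. ln (f y t)) x
      + c * exp (ln (f x t) * (p - 1)) + a / t"
    unfolding lap_eq g_eq E_eq by linarith
qed

end
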